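(* Let $\mathcal V$ be a variety of bounded $\lambda$-lattices $(L,\sqcup,\sqcap,{}',0,1)$ with a unary operation satisfying the identities $$0'\approx1,\quad x\sqcap x'\approx0\quad\text{and}\quad x\sqcup(x'\sqcap(x\sqcup y))\approx x\sqcup y .$$ Then $\mathcal V$ is congruence regular. In particular, the variety $\mathcal{L}s$, consisting of all bounded $\lambda$-lattices $\mathbf L$ with a unary operation whose induced poset $\mathbb P(\mathbf L)$ is skew-orthomodular, is congruence regular.
   Context: A bounded $\lambda$-lattice is an algebra $(L,\sqcup,\sqcap,0,1)$ of type $(2,2,0,0)$ satisfying the identities $x\sqcup y\approx y\sqcup x$, $x\sqcap y\approx y\sqcap x$, $x\sqcup((x\sqcup y)\sqcup z)\approx(x\sqcup y)\sqcup z$, $x\sqcap((x\sqcap y)\sqcap z)\approx(x\sqcap y)\sqcap z$, $x\sqcup(x\sqcap y)\approx x$, $x\sqcap(x\sqcup y)\approx x$, $x\sqcup0\approx x$, $x\sqcup1\approx1$. A bounded $\lambda$-lattice with a unary operation is an algebra $\mathbf L=(L,\sqcup,\sqcap,{}',0,1)$ such that $(L,\sqcup,\sqcap,0,1)$ is a bounded $\lambda$-lattice and ${}'$ is a unary operation on $L$. Its induced bounded poset with a unary operation is $\mathbb P(\mathbf L)=(L,\leq,{}',0,1)$, where $x\leq y$ if and only if $x\sqcup y=y$. Let $\mathbf P=(P,\leq,{}',0,1)$ be a bounded poset (least element $0$, greatest element $1$) with a unary operation ${}'$; $a\vee b$ and $a\wedge b$ denote $\sup(a,b)$ and $\inf(a,b)$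 whenever these exist. $\mathbf P$ is complemented if for every $x\in P$ the elements $x\vee x'$ and $x\wedge x'$ exist with $x\vee x'=1$ and $x\wedge x'=0$. A complemented poset is orthogonal if $x\vee y$ exists for all $x,y\in P$ with $x\leq y'$. An orthogonal poset is almost skew-orthomodular if $x\vee(x'\wedge y)$ exists (i.e. $x'\wedge y$ exists and its join with $x$ exists) for all $x,y\in P$ with $x\leq y$. An almost skew-orthomodular poset is skew-orthomodular if $x\vee(x'\wedge y)=y$ for all $x,y\in P$ with $x\leq y$. A variety $\mathcal V$ is congruence regular if for each $\mathbf A\in\mathcal V$ with universe $A$, each $a\in A$ and all congruences $\Theta,\Phi$ of $\mathbf A$ with $[a]\Theta=[a]\Phi$ we have $\Theta=\Phi$; here $[a]\Theta$ is the $\Theta$-class of $a$. *)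

theory Defs
  imports "HOL-Algebra.Order"
begin

section \<open>Bounded lambda-lattices\<close>

record 'a blattice = "'a partial_object" +
  ljoin :: "'a \<Rightarrow> 'a \<Rightarrow> 'a" (infixl \<open>\<squnion>\<index>\<close> 65)
  lmeet :: "'a \<Rightarrow> 'a \<Rightarrow> 'a" (infixl \<open>\<sqinter>\<index>\<close> 70)
  lzero :: 'a (\<open>\<zero>\<index>\<close>)
  lone :: 'a (\<open>\<one>\<index>\<close>)

record 'a ublattice = "'a blattice" +
  lcompl :: "'a \<Rightarrow> 'a" (\<open>_\<acute>\<index>\<close> [91] 90)

locale bounded_lambda_lattice =
  fixes L :: "('a, 'b) blattice_scheme" (structure)
  assumes join_closed: "\<lbrakk>x \<in> carrier L; y \<in> carrier L\<rbrakk> \<Longrightarrow> x \<squnion> y \<in> carrier L"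
    and meet_closed: "\<lbrakk>x \<in> carrier L; y \<in> carrier L\<rbrakk> \<Longrightarrow> x \<sqinter> y \<in> carrier L"
    and zero_closed: "\<zero> \<in> carrier L"
    and one_closed: "\<one> \<in> carrier L"
    and join_comm: "\<lbrakk>x \<in> carrier L; y \<in> carrier L\<rbrakk> \<Longrightarrow> x \<squnion> y = y \<squnion> x"
    and meet_comm: "\<lbrakk>x \<in> carrier L; y \<in> carrier L\<rbrakk> \<Longrightarrow> x \<sqinter> y = y \<sqinter> x"
    and join_weak_assoc:
      "\<lbrakk>x \<in> carrier L; y \<in> carrier L; z \<in> carrier L\<rbrakk>
        \<Longrightarrow> x \<squnion> ((x \<squnion> y) \<squnion> z) = (x \<squnion> y) \<squnion> z"
    and meet_weak_assoc:
      "\<lbrakk>x \<in> carrier L; y \<in> carrier L; z \<in> carrier L\<rbrakk>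
        \<Longrightarrow> x \<sqinter> ((x \<sqinter> y) \<sqinter> z) = (x \<sqinter> y) \<sqinter> z"
    and join_absorb: "\<lbrakk>x \<in> carrier L; y \<in> carrier L\<rbrakk> \<Longrightarrow> x \<squnion> (x \<sqinter> y) = x"
    and meet_absorb: "\<lbrakk>x \<in> carrier L; y \<in> carrier L\<rbrakk> \<Longrightarrow> x \<sqinter> (x \<squnion> y) = x"
    and join_zero: "x \<in> carrier L \<Longrightarrow> x \<squnion> \<zero> = x"
    and join_one: "x \<in> carrier L \<Longrightarrow> x \<squnion> \<one> = \<one>"

locale bounded_lambda_lattice_unary = bounded_lambda_lattice L
  for L :: "('a, 'b) ublattice_scheme" (structure) +
  assumes compl_closed: "x \<in> carrier L \<Longrightarrow> x\<acute> \<in> carrier L"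


section \<open>Bounded posets with a unary operation\<close>

record 'a uposet = "'a gorder" +
  pcompl :: "'a \<Rightarrow> 'a"
  pbot :: 'a
  ptop :: 'a

definition induced_poset :: "('a, 'b) ublattice_scheme \<Rightarrow> 'a uposet" where
  "induced_poset L =
    \<lparr>carrier = carrier L, eq = (=), le = (\<lambda>x y. x \<squnion>\<^bsub>L\<^esub> y = y),
     pcompl = lcompl L, pbot = \<zero>\<^bsub>L\<^esub>, ptop = \<one>\<^bsub>L\<^esub>\<rparr>"

text \<open>
  Suprema and infima are partial. ``$a \vee b$ exists and equals $c$'' is rendered by
  \<open>is_lub P c {a, b}\<close>, and dually for infima; existence alone by an existential quantifier.
  In particular they are taken in the order, and not by means of the operations of a
  lambda-lattice.
\<close>

locale bounded_poset_unary = partial_order P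
  for P :: "('a, 'b) uposet_scheme" (structure) +
  assumes pcompl_closed: "x \<in> carrier P \<Longrightarrow> pcompl P x \<in> carrier P"
    and pbot_least: "least P (pbot P) (carrier P)"
    and ptop_greatest: "greatest P (ptop P) (carrier P)"

locale complemented_poset = bounded_poset_unary +
  assumes compl_lub: "x \<in> carrier P \<Longrightarrow> is_lub P (ptop P) {x, pcompl P x}"
    and compl_glb: "x \<in> carrier P \<Longrightarrow> is_glb P (pbot P) {x, pcompl P x}"

locale orthogonal_poset = complemented_poset +
  assumes orthogonal_lub:
    "\<lbrakk>x \<in> carrier P; y \<in> carrier P; x \<sqsubseteq> pcompl P y\<rbrakk> \<Longrightarrow> \<exists>s. is_lub P s {x, y}"

locale almost_skew_orthomodular_poset = orthogonal_poset +
  assumes almost_skew_orthomodular: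
    "\<lbrakk>x \<in> carrier P; y \<in> carrier P; x \<sqsubseteq> y\<rbrakk>
      \<Longrightarrow> \<exists>m s. is_glb P m {pcompl P x, y} \<and> is_lub P s {x, m}"

locale skew_orthomodular_poset = almost_skew_orthomodular_poset +
  assumes skew_orthomodular:
    "\<lbrakk>x \<in> carrier P; y \<in> carrier P; x \<sqsubseteq> y; is_glb P m {pcompl P x, y}; is_lub P s {x, m}\<rbrakk>
      \<Longrightarrow> s = y"

lemma (in bounded_lambda_lattice_unary) bounded_poset_unary_induced_poset:
  "bounded_poset_unary (induced_poset L)"
proof -
  have trans: "x \<squnion> z = z"
    if "x \<in> carrier L" "y \<in> carrier L" "z \<in> carrier L" "x \<squnion> y = y" "y \<squnion> z = z" for x y z
    using join_weak_assoc[of x y z] that by simp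
  have refl: "x \<squnion> x = x" if "x \<in> carrier L" for x
    using that join_absorb[of x "x \<squnion> x"] meet_absorb[of x x] join_closed[of x x] by simp
  have antisym: "x = y"
    if "x \<in> carrier L" "y \<in> carrier L" "x \<squnion> y = y" "y \<squnion> x = x" for x y
    using that join_comm[of x y] by simp
  show ?thesis
  proof (unfold_locales, goal_cases)
    case (5 x y)
    then show ?case by (auto simp: induced_poset_def intro: antisym)
  next
    case (6 x y z)
    then show ?case by (auto simp: induced_poset_def intro: trans[of x y z])
  qed (auto simp: induced_poset_def least_def greatest_def refl zero_closed one_closed
      compl_closed join_one join_zero join_comm[of \<zero>])
qed


section \<open>Varieties\<close>

text \<open>Terms over the signature $(\sqcup, \sqcap, {}', 0, 1)$ with countably many variables.\<close>

datatype lterm =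
    Var nat
  | Join lterm lterm
  | Meet lterm lterm
  | Compl lterm
  | Zero
  | One

primrec term_value :: "('a, 'b) ublattice_scheme \<Rightarrow> (nat \<Rightarrow> 'a) \<Rightarrow> lterm \<Rightarrow> 'a" where
  "term_value L v (Var n) = v n"
| "term_value L v (Join s t) = term_value L v s \<squnion>\<^bsub>L\<^esub> term_value L v t"
| "term_value L v (Meet s t) = term_value L v s \<sqinter>\<^bsub>L\<^esub> term_value L v t"
| "term_value L v (Compl t) = (term_value L v t)\<acute>\<^bsub>L\<^esub>"
| "term_value L v Zero = \<zero>\<^bsub>L\<^esub>"
| "term_value L v One = \<one>\<^bsub>L\<^esub>"

definition satisfies :: "('a, 'b) ublattice_scheme \<Rightarrow> lterm \<times> lterm \<Rightarrow> bool" where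
  "satisfies L e \<longleftrightarrow>
    (\<forall>v. range v \<subseteq> carrier L \<longrightarrow> term_value L v (fst e) = term_value L v (snd e))"

text \<open>
  Being an algebra of the signature: the universe, nonempty because of the constants, is closed
  under the operations. No identity is imposed.
\<close>

definition algebra :: "('a, 'b) ublattice_scheme \<Rightarrow> bool" where
  "algebra L \<longleftrightarrow>
    \<zero>\<^bsub>L\<^esub> \<in> carrier L \<and> \<one>\<^bsub>L\<^esub> \<in> carrier L \<and>
    (\<forall>x\<in>carrier L. x\<acute>\<^bsub>L\<^esub> \<in> carrier L) \<and>
    (\<forall>x\<in>carrier L. \<forall>y\<in>carrier L. x \<squnion>\<^bsub>L\<^esub> y \<in> carrier L \<and> x \<sqinter>\<^bsub>L\<^esub> y \<in> carrier L)"

text \<open>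
  A variety is an equational class: all algebras of the signature that satisfy a given set of
  identities. A class consists here of algebras whose universe is a subset of an arbitrary
  type \<open>'a\<close>.
\<close>

definition variety :: "'a ublattice set \<Rightarrow> bool" where
  "variety V \<longleftrightarrow> (\<exists>E. V = {L. algebra L \<and> (\<forall>e\<in>E. satisfies L e)})"


section \<open>Congruence regularity\<close>

definition congruence :: "('a, 'b) ublattice_scheme \<Rightarrow> 'a rel \<Rightarrow> bool" where
  "congruence L \<Theta> \<longleftrightarrow>
    equiv (carrier L) \<Theta> \<and>
    (\<forall>(x, y)\<in>\<Theta>. (x\<acute>\<^bsub>L\<^esub>, y\<acute>\<^bsub>L\<^esub>) \<in> \<Theta>) \<and>
    (\<forall>(x, y)\<in>\<Theta>. \<forall>(u, w)\<in>\<Theta>.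
      (x \<squnion>\<^bsub>L\<^esub> u, y \<squnion>\<^bsub>L\<^esub> w) \<in> \<Theta> \<and> (x \<sqinter>\<^bsub>L\<^esub> u, y \<sqinter>\<^bsub>L\<^esub> w) \<in> \<Theta>)"

definition congruence_regular :: "'a ublattice set \<Rightarrow> bool" where
  "congruence_regular V \<longleftrightarrow>
    (\<forall>L\<in>V. \<forall>a\<in>carrier L. \<forall>\<Theta> \<Phi>. congruence L \<Theta> \<longrightarrow> congruence L \<Phi> \<longrightarrow>
      \<Theta> `` {a} = \<Phi> `` {a} \<longrightarrow> \<Theta> = \<Phi>)"

definition skew_orthomodular_lambda_lattices :: "'a ublattice set" (\<open>\<L>s\<close>) where
  "\<L>s = {L. bounded_lambda_lattice_unary L \<and> skew_orthomodular_poset (induced_poset L)}"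

end

theory Submission
  imports Defs
begin

text \<open>
  A congruence is determined by its comparable pairs, since $x \mathrel\Theta y$ iff both are
  congruent to $x \sqcup y$. For $x \le w$ there is an element $m$ such that every congruence
  identifies $x$ with $w$ iff it identifies $m$ with $0$: take $m = x' \sqcap w$ under the
  identities, and the infimum $m = x' \wedge w$ in the skew-orthomodular case.
  The two elements can differ: $\sqcap$ need not yield the infimum even if the latter exists, so
  the members of \<open>\<L>s\<close> need not satisfy the third identity. Finally, for any $a$, an element $m$
  is congruent to $0$ iff $a \sqcup m$ and $a \sqcap m'$ are congruent to $a$, because
  $m \le a \le m'$ forces $m = m \sqcap m' = 0$ in the quotient.
\<close>

section \<open>Arithmetic of bounded \<lambda>-lattices and their order\<close>

context bounded_lambda_lattice
begin

text \<open>Absorption used twice: \<open>x \<sqinter> (x \<squnion> x) = x\<close>, and putting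
  this into \<open>x \<squnion> (x \<sqinter> (x \<squnion> x)) = x\<close> leaves the
  claim.\<close>

lemma join_idem: "x \<in> carrier L \<Longrightarrow> x \<squnion> x = x"
  using join_absorb[of x "x \<squnion> x"] meet_absorb[of x x] join_closed[of x x] by simp

text \<open>Weak associativity with \<open>\<zero>\<close> as third argument, which the outer join
  absorbs.\<close>

lemma join_upper: "\<lbrakk>x \<in> carrier L; y \<in> carrier L\<rbrakk> \<Longrightarrow> x \<squnion> (x \<squnion> y) = x \<squnion> y"
  using join_weak_assoc[of x y \<zero>] by (simp add: join_closed join_zero zero_closed)

lemma join_trans:
  "\<lbrakk>x \<in> carrier L; y \<in> carrier L; z \<in> carrier L; x \<squnion> y = y; y \<squnion> z = z\<rbrakk> \<Longrightarrow> x \<squnion> z = z"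
  using join_weak_assoc[of x y z] by simp

lemma meet_eq_left: "\<lbrakk>x \<in> carrier L; y \<in> carrier L; x \<squnion> y = y\<rbrakk> \<Longrightarrow> x \<sqinter> y = x"
  using meet_absorb[of x y] by simp

lemma meet_one: "x \<in> carrier L \<Longrightarrow> x \<sqinter> \<one> = x"
  by (simp add: meet_eq_left one_closed join_one)

lemma meet_join_left: "\<lbrakk>x \<in> carrier L; y \<in> carrier L\<rbrakk> \<Longrightarrow> (x \<sqinter> y) \<squnion> x = x"
  by (simp add: join_comm join_absorb meet_closed)

lemma meet_join_right: "\<lbrakk>x \<in> carrier L; y \<in> carrier L\<rbrakk> \<Longrightarrow> (x \<sqinter> y) \<squnion> y = y"
  using meet_join_left[of y x] by (simp add: meet_comm)

end

section \<open>Elementwise rules for congruences\<close>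

lemma congruence_carrier:
  assumes "congruence L \<Theta>" "(x, y) \<in> \<Theta>"
  shows "x \<in> carrier L" "y \<in> carrier L"
  using assms by (auto simp: congruence_def equiv_def refl_on_def)

lemma congruence_refl: "\<lbrakk>congruence L \<Theta>; x \<in> carrier L\<rbrakk> \<Longrightarrow> (x, x) \<in> \<Theta>"
  by (auto simp: congruence_def equiv_def refl_on_def)

lemma congruence_sym: "\<lbrakk>congruence L \<Theta>; (x, y) \<in> \<Theta>\<rbrakk> \<Longrightarrow> (y, x) \<in> \<Theta>"
  by (auto simp: congruence_def equiv_def dest: symD)

lemma congruence_trans: "\<lbrakk>congruence L \<Theta>; (x, y) \<in> \<Theta>; (y, z) \<in> \<Theta>\<rbrakk> \<Longrightarrow> (x, z) \<in> \<Theta>"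
  by (auto simp: congruence_def equiv_def dest: transD)

lemma congruence_compl:
  "\<lbrakk>congruence L \<Theta>; (x, y) \<in> \<Theta>\<rbrakk> \<Longrightarrow> (x\<acute>\<^bsub>L\<^esub>, y\<acute>\<^bsub>L\<^esub>) \<in> \<Theta>"
  by (auto simp: congruence_def)

lemma congruence_join:
  "\<lbrakk>congruence L \<Theta>; (x, y) \<in> \<Theta>; (u, w) \<in> \<Theta>\<rbrakk> \<Longrightarrow> (x \<squnion>\<^bsub>L\<^esub> u, y \<squnion>\<^bsub>L\<^esub> w) \<in> \<Theta>"
  by (fastforce simp: congruence_def)

lemma congruence_meet:
  "\<lbrakk>congruence L \<Theta>; (x, y) \<in> \<Theta>; (u, w) \<in> \<Theta>\<rbrakk> \<Longrightarrow> (x \<sqinter>\<^bsub>L\<^esub> u, y \<sqinter>\<^bsub>L\<^esub> w) \<in> \<Theta>"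
  by (fastforce simp: congruence_def)

section \<open>Congruences and the class of one element\<close>

context bounded_lambda_lattice_unary
begin

text \<open>Both conditions on the right only ask whether an element lies in the class of
  \<open>a\<close>, so this class decides which elements are congruent to
  \<open>\<zero>\<close>.\<close>

lemma congruence_zero_iff:
  assumes \<Theta>: "congruence L \<Theta>"
    and a: "a \<in> carrier L" and m: "m \<in> carrier L"
    and zero_compl: "\<zero>\<acute> = \<one>" and meet_compl: "m \<sqinter> m\<acute> = \<zero>"
  shows "(m, \<zero>) \<in> \<Theta> \<longleftrightarrow> (a \<squnion> m, a) \<in> \<Theta> \<and> (a \<sqinter> m\<acute>, a) \<in> \<Theta>"
proof
  assume "(m, \<zero>) \<in> \<Theta>"
  then have "(a \<squnion> m, a \<squnion> \<zero>) \<in> \<Theta>" "(a \<sqinter> m\<acute>, a \<sqinter> \<zero>\<acute>) \<in> \<Theta>"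
    by (intro congruence_join[OF \<Theta>] congruence_meet[OF \<Theta>] congruence_compl[OF \<Theta>]
        congruence_refl[OF \<Theta> a]; assumption)+
  then show "(a \<squnion> m, a) \<in> \<Theta> \<and> (a \<sqinter> m\<acute>, a) \<in> \<Theta>"
    by (simp add: a zero_compl join_zero meet_one)
next
  note cr = congruence_refl[OF \<Theta>] and cs = congruence_sym[OF \<Theta>] and ct = congruence_trans[OF \<Theta>]
  assume "(a \<squnion> m, a) \<in> \<Theta> \<and> (a \<sqinter> m\<acute>, a) \<in> \<Theta>"
  then have le1: "(m \<squnion> a, a) \<in> \<Theta>" and le2: "(a \<sqinter> m\<acute>, a) \<in> \<Theta>"
    using a m by (simp_all add: join_comm)
  have m': "m\<acute> \<in> carrier L" using m by (rule compl_closed)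
  \<comment> \<open>Absorption makes the left side \<open>m\<acute>\<close>, so this expresses a
    \<le> m' modulo \<open>\<Theta>\<close>.\<close>
  have "((a \<sqinter> m\<acute>) \<squnion> m\<acute>, a \<squnion> m\<acute>) \<in> \<Theta>"
    by (rule congruence_join[OF \<Theta> le2 cr[OF m']])
  then have m'_ge_a: "(m\<acute>, a \<squnion> m\<acute>) \<in> \<Theta>"
    by (simp add: meet_join_right a m')
  \<comment> \<open>Transitivity modulo \<open>\<Theta>\<close>, done inside L:
    \<open>(m \<squnion> a) \<squnion> m\<acute>\<close> is congruent to \<open>m\<acute>\<close>,
    yet by weak associativity it lies above \<open>m\<close> exactly. Hence its meet with
    \<open>m\<close> is \<open>m\<close> itself.\<close>
  have "((m \<squnion> a) \<squnion> m\<acute>, a \<squnion> m\<acute>) \<in> \<Theta>"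
    by (rule congruence_join[OF \<Theta> le1 cr[OF m']])
  then have "(m\<acute>, (m \<squnion> a) \<squnion> m\<acute>) \<in> \<Theta>"
    using m'_ge_a cs ct by blast
  then have "(m \<sqinter> ((m \<squnion> a) \<squnion> m\<acute>), m \<sqinter> m\<acute>) \<in> \<Theta>"
    by (rule congruence_meet[OF \<Theta> cr[OF m] cs])
  moreover have "m \<sqinter> ((m \<squnion> a) \<squnion> m\<acute>) = m"
    using m a m' by (intro meet_eq_left join_weak_assoc join_closed)
  ultimately show "(m, \<zero>) \<in> \<Theta>"
    by (simp add: meet_compl)
qed

lemma congruence_join_iff:
  assumes \<Theta>: "congruence L \<Theta>" and x: "x \<in> carrier L" and y: "y \<in> carrier L"
  shows "(x, y) \<in> \<Theta> \<longleftrightarrow> (x, x \<squnion> y) \<in> \<Theta> \<and> (y, x \<squnion> y) \<in> \<Theta>"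
proof
  assume xy: "(x, y) \<in> \<Theta>"
  have "(x \<squnion> x, x \<squnion> y) \<in> \<Theta>" "(y \<squnion> y, x \<squnion> y) \<in> \<Theta>"
    using congruence_join[OF \<Theta>] congruence_refl[OF \<Theta>] congruence_sym[OF \<Theta>] x y xy by blast+
  then show "(x, x \<squnion> y) \<in> \<Theta> \<and> (y, x \<squnion> y) \<in> \<Theta>"
    using x y by (simp add: join_idem)
qed (blast intro: congruence_sym[OF \<Theta>] congruence_trans[OF \<Theta>])

text \<open>The assumption \<open>difference\<close> is the common interface of the two cases of the
  theorem. There \<open>m\<close> is chosen before the congruence, so the same \<open>m\<close>
  serves \<open>\<Theta>\<close> and \<open>\<Phi>\<close>.\<close>

lemma congruence_determined_by_class:
  assumes zero_compl: "\<zero>\<acute> = \<one>"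
    and meet_compl: "\<And>x. x \<in> carrier L \<Longrightarrow> x \<sqinter> x\<acute> = \<zero>"
    and difference: "\<And>x w. \<lbrakk>x \<in> carrier L; w \<in> carrier L; x \<squnion> w = w\<rbrakk> \<Longrightarrow>
      \<exists>m\<in>carrier L. \<forall>\<Theta>. congruence L \<Theta> \<longrightarrow> ((x, w) \<in> \<Theta> \<longleftrightarrow> (m, \<zero>) \<in> \<Theta>)"
    and a: "a \<in> carrier L"
    and \<Theta>: "congruence L \<Theta>" and \<Phi>: "congruence L \<Phi>"
    and class_eq: "\<Theta> `` {a} = \<Phi> `` {a}"
  shows "\<Theta> = \<Phi>"
proof -
  \<comment> \<open>The equality of classes, turned around by symmetry to fit the shape of
    \<open>congruence_zero_iff\<close>.\<close>
  have "(z, a) \<in> \<Theta> \<longleftrightarrow> (z, a) \<in> \<Phi>" for z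
    using class_eq congruence_sym[OF \<Theta>] congruence_sym[OF \<Phi>] by blast
  then have zero: "(m, \<zero>) \<in> \<Theta> \<longleftrightarrow> (m, \<zero>) \<in> \<Phi>" if "m \<in> carrier L" for m
    using that by (simp add: congruence_zero_iff[OF _ a] \<Theta> \<Phi> zero_compl meet_compl)
  have comparable: "(x, w) \<in> \<Theta> \<longleftrightarrow> (x, w) \<in> \<Phi>"
    if "x \<in> carrier L" "w \<in> carrier L" "x \<squnion> w = w" for x w
    using difference[OF that] zero \<Theta> \<Phi> by blast
  have "(x, y) \<in> \<Theta> \<longleftrightarrow> (x, y) \<in> \<Phi>" if x: "x \<in> carrier L" and y: "y \<in> carrier L" for x y
  proof -
    have "(x, x \<squnion> y) \<in> \<Theta> \<longleftrightarrow> (x, x \<squnion> y) \<in> \<Phi>"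
      using x y by (intro comparable join_closed join_upper)
    moreover have "(y, x \<squnion> y) \<in> \<Theta> \<longleftrightarrow> (y, x \<squnion> y) \<in> \<Phi>"
      using x y join_upper[of y x] by (intro comparable join_closed) (simp_all add: join_comm)
    ultimately show ?thesis
      using congruence_join_iff[OF \<Theta> x y] congruence_join_iff[OF \<Phi> x y] by simp
  qed
  then show ?thesis
    by (intro equalityI subrelI) (blast dest: congruence_carrier[OF \<Theta>] congruence_carrier[OF \<Phi>])+
qed

text \<open>Meeting the pair with \<open>x\<acute>\<close> sends \<open>x\<close> to
  \<open>\<zero>\<close>; joining \<open>x\<acute> \<sqinter> w\<close> and \<open>\<zero>\<close>
  with \<open>x\<close> recovers \<open>w\<close> and \<open>x\<close>.\<close>

lemma difference_by_identity:
  assumes meet_compl: "x \<sqinter> x\<acute> = \<zero>"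
    and join_compl: "x \<squnion> (x\<acute> \<sqinter> w) = w"
    and x: "x \<in> carrier L" and w: "w \<in> carrier L" and \<Theta>: "congruence L \<Theta>"
  shows "(x, w) \<in> \<Theta> \<longleftrightarrow> (x\<acute> \<sqinter> w, \<zero>) \<in> \<Theta>"
proof
  have x': "x\<acute> \<in> carrier L" using x by (rule compl_closed)
  assume "(x, w) \<in> \<Theta>"
  then have "(x\<acute> \<sqinter> w, x\<acute> \<sqinter> x) \<in> \<Theta>"
    by (rule congruence_meet[OF \<Theta> congruence_refl[OF \<Theta> x'] congruence_sym[OF \<Theta>]])
  then show "(x\<acute> \<sqinter> w, \<zero>) \<in> \<Theta>"
    using meet_compl x x' by (simp add: meet_comm)
next
  assume "(x\<acute> \<sqinter> w, \<zero>) \<in> \<Theta>"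
  then have "(x \<squnion> \<zero>, x \<squnion> (x\<acute> \<sqinter> w)) \<in> \<Theta>"
    by (rule congruence_join[OF \<Theta> congruence_refl[OF \<Theta> x] congruence_sym[OF \<Theta>]])
  then show "(x, w) \<in> \<Theta>"
    using join_compl x by (simp add: join_zero)
qed

section \<open>Suprema and infima in the induced order\<close>

lemma is_lub_induced_iff:
  assumes "x \<in> carrier L" "y \<in> carrier L"
  shows "is_lub (induced_poset L) s {x, y} \<longleftrightarrow>
    s \<in> carrier L \<and> x \<squnion> s = s \<and> y \<squnion> s = s \<and>
    (\<forall>u\<in>carrier L. x \<squnion> u = u \<and> y \<squnion> u = u \<longrightarrow> s \<squnion> u = u)"
  using assms by (auto simp: induced_poset_def least_def Upper_def)

lemma is_glb_induced_iff:
  assumes "x \<in> carrier L" "y \<in> carrier L"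
  shows "is_glb (induced_poset L) m {x, y} \<longleftrightarrow>
    m \<in> carrier L \<and> m \<squnion> x = x \<and> m \<squnion> y = y \<and>
    (\<forall>u\<in>carrier L. u \<squnion> x = x \<and> u \<squnion> y = y \<longrightarrow> u \<squnion> m = m)"
  using assms by (auto simp: induced_poset_def greatest_def Lower_def)

lemma is_glb_induced_closed: "is_glb (induced_poset L) m A \<Longrightarrow> m \<in> carrier L"
  by (auto simp: induced_poset_def greatest_def Lower_def)

text \<open>The operations give only some common lower or upper bound. Comparing these bounds with
  the true infimum \<open>\<zero>\<close> of \<open>x\<close> and \<open>x\<acute>\<close>, and with
  the true supremum \<open>w\<close> of \<open>x\<close> and \<open>m\<close>, is enough.\<close>

lemma difference_by_infimum:
  assumes x: "x \<in> carrier L" and w: "w \<in> carrier L" and \<Theta>: "congruence L \<Theta>"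
    and glb_zero: "is_glb (induced_poset L) \<zero> {x, x\<acute>}"
    and glb: "is_glb (induced_poset L) m {x\<acute>, w}"
    and lub: "is_lub (induced_poset L) w {x, m}"
  shows "(x, w) \<in> \<Theta> \<longleftrightarrow> (m, \<zero>) \<in> \<Theta>"
proof
  have x': "x\<acute> \<in> carrier L" using x by (rule compl_closed)
  from glb have m: "m \<in> carrier L" and mw: "m \<squnion> w = w" and mx': "m \<squnion> x\<acute> = x\<acute>"
    unfolding is_glb_induced_iff[OF x' w] by blast+
  have mx: "m \<sqinter> x \<in> carrier L" using m x by (rule meet_closed)
  \<comment> \<open>Since m \<le> x', the element \<open>m \<sqinter> x\<close> is a common lower
    bound of \<open>x\<close> and \<open>x\<acute>\<close>, hence below their infimum
    \<open>\<zero>\<close>.\<close>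
  have "(m \<sqinter> x) \<squnion> x\<acute> = x\<acute>"
    by (rule join_trans[OF mx m x' meet_join_left[OF m x] mx'])
  moreover have "(m \<sqinter> x) \<squnion> x = x"
    using m x by (rule meet_join_right)
  ultimately have "(m \<sqinter> x) \<squnion> \<zero> = \<zero>"
    using glb_zero mx unfolding is_glb_induced_iff[OF x x'] by blast
  then have "m \<sqinter> x = \<zero>"
    using mx by (simp add: join_zero)
  assume "(x, w) \<in> \<Theta>"
  then have "(m \<sqinter> w, m \<sqinter> x) \<in> \<Theta>"
    by (rule congruence_meet[OF \<Theta> congruence_refl[OF \<Theta> m] congruence_sym[OF \<Theta>]])
  then show "(m, \<zero>) \<in> \<Theta>"
    using \<open>m \<sqinter> x = \<zero>\<close> meet_eq_left[OF m w mw] by simp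
next
  have m: "m \<in> carrier L" using glb by (rule is_glb_induced_closed)
  from lub have xw: "x \<squnion> w = w"
    and least: "\<And>u. \<lbrakk>u \<in> carrier L; x \<squnion> u = u; m \<squnion> u = u\<rbrakk> \<Longrightarrow> w \<squnion> u = u"
    unfolding is_lub_induced_iff[OF x m] by blast+
  \<comment> \<open>\<open>x \<squnion> m\<close> may be strictly above \<open>w\<close>, so it
    cannot be replaced by \<open>w\<close>; the meet with \<open>w\<close> below cuts it down to
    \<open>w\<close>.\<close>
  have "w \<squnion> (x \<squnion> m) = x \<squnion> m"
    using x m join_upper[of m x]
    by (intro least join_closed join_upper) (simp_all add: join_comm)
  then have "w \<sqinter> (x \<squnion> m) = w"
    using w x m by (intro meet_eq_left join_closed)
  moreover have "w \<sqinter> x = x"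
    using meet_eq_left[OF x w xw] x w by (simp add: meet_comm)
  moreover assume "(m, \<zero>) \<in> \<Theta>"
  then have "(\<zero>, m) \<in> \<Theta>"
    by (rule congruence_sym[OF \<Theta>])
  then have "(w \<sqinter> (x \<squnion> \<zero>), w \<sqinter> (x \<squnion> m)) \<in> \<Theta>"
    by (intro congruence_meet[OF \<Theta>] congruence_join[OF \<Theta>] congruence_refl[OF \<Theta>] x w)
  ultimately show "(x, w) \<in> \<Theta>"
    using x by (simp add: join_zero)
qed

end

section \<open>Congruence regularity in the two cases\<close>

lemma congruence_regular_if_identities:
  fixes V :: "'a ublattice set"
  assumes lattice: "\<And>L. L \<in> V \<Longrightarrow> bounded_lambda_lattice_unary L"
    and zero_compl: "\<And>L. L \<in> V \<Longrightarrow> \<zero>\<^bsub>L\<^esub>\<acute>\<^bsub>L\<^esub> = \<one>\<^bsub>L\<^esub>"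
    and meet_compl: "\<And>L x. \<lbrakk>L \<in> V; x \<in> carrier L\<rbrakk> \<Longrightarrow> x \<sqinter>\<^bsub>L\<^esub> x\<acute>\<^bsub>L\<^esub> = \<zero>\<^bsub>L\<^esub>"
    and join_compl: "\<And>L x y. \<lbrakk>L \<in> V; x \<in> carrier L; y \<in> carrier L\<rbrakk> \<Longrightarrow>
      x \<squnion>\<^bsub>L\<^esub> (x\<acute>\<^bsub>L\<^esub> \<sqinter>\<^bsub>L\<^esub> (x \<squnion>\<^bsub>L\<^esub> y)) = x \<squnion>\<^bsub>L\<^esub> y"
  shows "congruence_regular V"
  unfolding congruence_regular_def
proof (intro ballI allI impI)
  fix L a \<Theta> \<Phi>
  assume L: "L \<in> V" and a: "a \<in> carrier L"
    and \<Theta>: "congruence L \<Theta>" and \<Phi>: "congruence L \<Phi>" and class_eq: "\<Theta> `` {a} = \<Phi> `` {a}"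
  interpret bounded_lambda_lattice_unary L using lattice[OF L] .
  show "\<Theta> = \<Phi>"
  proof (rule congruence_determined_by_class[OF zero_compl[OF L] meet_compl[OF L] _ a \<Theta> \<Phi> class_eq])
    fix x w
    assume x: "x \<in> carrier L" and w: "w \<in> carrier L" and "x \<squnion>\<^bsub>L\<^esub> w = w"
    \<comment> \<open>The third identity at \<open>y = w\<close>, where the join of \<open>x\<close>
      and \<open>w\<close> collapses to \<open>w\<close>.\<close>
    then have "x \<squnion>\<^bsub>L\<^esub> (x\<acute>\<^bsub>L\<^esub> \<sqinter>\<^bsub>L\<^esub> w) = w"
      using join_compl[OF L x w] by simp
    then have "\<forall>\<Theta>. congruence L \<Theta> \<longrightarrow> ((x, w) \<in> \<Theta> \<longleftrightarrow> (x\<acute>\<^bsub>L\<^esub> \<sqinter>\<^bsub>L\<^esub> w, \<zero>\<^bsub>L\<^esub>) \<in> \<Theta>)"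
      by (intro allI impI difference_by_identity[OF meet_compl[OF L x] _ x w])
    then show "\<exists>m\<in>carrier L. \<forall>\<Theta>. congruence L \<Theta> \<longrightarrow> ((x, w) \<in> \<Theta> \<longleftrightarrow> (m, \<zero>\<^bsub>L\<^esub>) \<in> \<Theta>)"
      using meet_closed[OF compl_closed[OF x] w] by blast
  qed
qed

text \<open>The first two identities do follow from complementedness of the order; only the
  difference element has to be taken as a true infimum.\<close>

lemma congruence_regular_skew_orthomodular: "congruence_regular (\<L>s :: 'a ublattice set)"
  unfolding congruence_regular_def
proof (intro ballI allI impI)
  fix L :: "'a ublattice" and a \<Theta> \<Phi>
  assume "L \<in> \<L>s" and a: "a \<in> carrier L"
    and \<Theta>: "congruence L \<Theta>" and \<Phi>: "congruence L \<Phi>" and class_eq: "\<Theta> `` {a} = \<Phi> `` {a}"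
  then interpret bounded_lambda_lattice_unary L
    by (simp add: skew_orthomodular_lambda_lattices_def)
  interpret P: skew_orthomodular_poset "induced_poset L"
    using \<open>L \<in> \<L>s\<close> by (simp add: skew_orthomodular_lambda_lattices_def)
  have poset_simps: "carrier (induced_poset L) = carrier L"
    "pcompl (induced_poset L) = lcompl L"
    "pbot (induced_poset L) = \<zero>\<^bsub>L\<^esub>" "ptop (induced_poset L) = \<one>\<^bsub>L\<^esub>"
    "x \<sqsubseteq>\<^bsub>induced_poset L\<^esub> y \<longleftrightarrow> x \<squnion>\<^bsub>L\<^esub> y = y" for x y
    by (simp_all add: induced_poset_def)
  have glb_zero: "is_glb (induced_poset L) \<zero>\<^bsub>L\<^esub> {x, x\<acute>\<^bsub>L\<^esub>}" if "x \<in> carrier L" for x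
    using P.compl_glb[of x] that by (simp only: poset_simps)
  show "\<Theta> = \<Phi>"
  proof (rule congruence_determined_by_class[OF _ _ _ a \<Theta> \<Phi> class_eq])
    \<comment> \<open>The complement of the zero is itself an upper bound of the zero and that
      complement, so it lies above their supremum, the one.\<close>
    have "is_lub (induced_poset L) \<one>\<^bsub>L\<^esub> {\<zero>\<^bsub>L\<^esub>, \<zero>\<^bsub>L\<^esub>\<acute>\<^bsub>L\<^esub>}"
      using P.compl_lub[of "\<zero>\<^bsub>L\<^esub>"] zero_closed by (simp only: poset_simps)
    moreover have z': "\<zero>\<^bsub>L\<^esub>\<acute>\<^bsub>L\<^esub> \<in> carrier L"
      by (intro compl_closed zero_closed)
    moreover have "\<zero>\<^bsub>L\<^esub> \<squnion>\<^bsub>L\<^esub> \<zero>\<^bsub>L\<^esub>\<acute>\<^bsub>L\<^esub> = \<zero>\<^bsub>L\<^esub>\<acute>\<^bsub>L\<^esub>"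
      using join_comm[OF zero_closed z'] join_zero[OF z'] by simp
    ultimately have "\<one>\<^bsub>L\<^esub> \<squnion>\<^bsub>L\<^esub> \<zero>\<^bsub>L\<^esub>\<acute>\<^bsub>L\<^esub> = \<zero>\<^bsub>L\<^esub>\<acute>\<^bsub>L\<^esub>"
      using join_idem[OF z'] unfolding is_lub_induced_iff[OF zero_closed z'] by blast
    then show "\<zero>\<^bsub>L\<^esub>\<acute>\<^bsub>L\<^esub> = \<one>\<^bsub>L\<^esub>"
      using join_comm[OF one_closed z'] join_one[OF z'] by simp
  next
    fix x
    assume x: "x \<in> carrier L"
    then have x': "x\<acute>\<^bsub>L\<^esub> \<in> carrier L" by (rule compl_closed)
    \<comment> \<open>Even if the operation does not yield infima in general, its value here is a
      common lower bound of \<open>x\<close> and its complement, whose infimum is zero.\<close>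
    have "(x \<sqinter>\<^bsub>L\<^esub> x\<acute>\<^bsub>L\<^esub>) \<squnion>\<^bsub>L\<^esub> \<zero>\<^bsub>L\<^esub> = \<zero>\<^bsub>L\<^esub>"
      using glb_zero[OF x] meet_join_left[OF x x'] meet_join_right[OF x x'] meet_closed[OF x x']
      unfolding is_glb_induced_iff[OF x x'] by blast
    then show "x \<sqinter>\<^bsub>L\<^esub> x\<acute>\<^bsub>L\<^esub> = \<zero>\<^bsub>L\<^esub>"
      using join_zero[OF meet_closed[OF x x']] by simp
  next
    fix x w
    assume x: "x \<in> carrier L" and w: "w \<in> carrier L" and xw: "x \<squnion>\<^bsub>L\<^esub> w = w"
    \<comment> \<open>Almost skew-orthomodularity supplies the infimum \<open>m\<close> and the
      supremum \<open>s\<close>; skew-orthomodularity then identifies \<open>s\<close> with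
      \<open>w\<close>.\<close>
    obtain m s where glb: "is_glb (induced_poset L) m {x\<acute>\<^bsub>L\<^esub>, w}"
      and lub: "is_lub (induced_poset L) s {x, m}"
      using P.almost_skew_orthomodular[of x w, unfolded poset_simps, OF x w xw] by blast
    have "s = w"
      by (rule P.skew_orthomodular[of x w m s, unfolded poset_simps, OF x w xw glb lub])
    then have "is_lub (induced_poset L) w {x, m}"
      using lub by (simp only:)
    then have "\<forall>\<Theta>. congruence L \<Theta> \<longrightarrow> ((x, w) \<in> \<Theta> \<longleftrightarrow> (m, \<zero>\<^bsub>L\<^esub>) \<in> \<Theta>)"
      by (intro allI impI difference_by_infimum[OF x w _ glb_zero[OF x] glb])
    moreover have "m \<in> carrier L"
      using glb by (rule is_glb_induced_closed)
    ultimately show "\<exists>m\<in>carrier L. \<forall>\<Theta>. congruence L \<Theta> \<longrightarrow> ((x, w) \<in> \<Theta> \<longleftrightarrow> (m, \<zero>\<^bsub>L\<^esub>) \<in> \<Theta>)"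
      by blast
  qed
qed

theorem theorem9:
  "(\<forall>V :: 'a ublattice set.
      variety V \<longrightarrow>
      (\<forall>L\<in>V. bounded_lambda_lattice_unary L \<and>
        \<zero>\<^bsub>L\<^esub>\<acute>\<^bsub>L\<^esub> = \<one>\<^bsub>L\<^esub> \<and>
        (\<forall>x\<in>carrier L. x \<sqinter>\<^bsub>L\<^esub> x\<acute>\<^bsub>L\<^esub> = \<zero>\<^bsub>L\<^esub>) \<and>
        (\<forall>x\<in>carrier L. \<forall>y\<in>carrier L.
          x \<squnion>\<^bsub>L\<^esub> (x\<acute>\<^bsub>L\<^esub> \<sqinter>\<^bsub>L\<^esub> (x \<squnion>\<^bsub>L\<^esub> y)) = x \<squnion>\<^bsub>L\<^esub> y)) \<longrightarrow>
      congruence_regular V) \<and>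
   congruence_regular (\<L>s :: 'a ublattice set)"
  by (intro conjI allI impI congruence_regular_if_identities congruence_regular_skew_orthomodular)
    simp_all

end
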